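(* Let $\ell\ge 3$ and $r\ge 2$ be integers and let $H=C_\ell^{+r}$. For every fixed $\varepsilon>0$ and every $p=p(n)\in[0,1]$ with $n^{-1/m_H}\ll p\ll 1$ we have, as $n\to\infty$, $$-\log \mathbb{P}\bigl(X_H \ge (1+\varepsilon)\,\mathbb{E} X_H\bigr) = o(\Phi_H).$$
   Context: All graphs are finite and simple; $v_G$, $e_G$ denote the numbers of vertices and edges of $G$. $C_\ell^{+r}$ is the graph obtained from the cycle $C_\ell$ on $\ell$ vertices by adding $r$ new vertices, each joined by a single edge to one and the same fixed vertex of the cycle (so it has $\ell+r$ vertices and $\ell+r$ edges). $G_{n,p}$ is the binomial random graph on vertex set $[n]$. For a fixed graph $G$, $X_G=X_G(n,p)$ is the number of copies of $G$ in $G_{n,p}$, i.e. of (not necessarily induced) subgraphs of $G_{n,p}$ isomorphic to $G$, and $\mu_G=\mathbb{E}X_G$. Set $m_H:=\max_{F\subseteq H:\,v_F\ge1}e_F/v_F$ and $\Phi_H=\Phi_H(n,p):=\min_{G\subseteq H:\,e_G\ge1}\mu_G$. Asymptotics are as $n\to\infty$, and $a\ll b$ means $a=o(b)$. *)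

theory Defs
  imports "HOL-Probability.Probability" "HOL-Library.Landau_Symbols"
begin

type_synonym 'a graph = "'a set \<times> 'a set set"

abbreviation verts :: "'a graph \<Rightarrow> 'a set" where "verts \<equiv> fst"
abbreviation edges :: "'a graph \<Rightarrow> 'a set set" where "edges \<equiv> snd"

definition simple_graph :: "'a graph \<Rightarrow> bool" where
  "simple_graph G \<longleftrightarrow> finite (verts G) \<and> (\<forall>e\<in>edges G. e \<subseteq> verts G \<and> card e = 2)"

definition subgraph :: "'a graph \<Rightarrow> 'a graph \<Rightarrow> bool" where
  "subgraph F G \<longleftrightarrow> simple_graph F \<and> verts F \<subseteq> verts G \<and> edges F \<subseteq> edges G"

definition isomorphic :: "'a graph \<Rightarrow> 'b graph \<Rightarrow> bool" where
  "isomorphic F G \<longleftrightarrow>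
     (\<exists>f. bij_betw f (verts F) (verts G) \<and>
          (\<forall>u\<in>verts F. \<forall>v\<in>verts F. {u, v} \<in> edges F \<longleftrightarrow> {f u, f v} \<in> edges G))"

text \<open>The cycle lives on \<open>0, \<dots>, l - 1\<close>; the \<open>r\<close> pendant vertices are
  \<open>l, \<dots>, l + r - 1\<close>, all attached to the cycle vertex \<open>0\<close>.\<close>

definition cycle_pendants :: "nat \<Rightarrow> nat \<Rightarrow> nat graph" where
  "cycle_pendants l r =
     ({..<l + r}, {{i, (i + 1) mod l} | i. i < l} \<union> {{0, j} | j. l \<le> j \<and> j < l + r})"

definition all_pairs :: "nat \<Rightarrow> nat set set" where
  "all_pairs n = {e. e \<subseteq> {1..n} \<and> card e = 2}"

definition binomial_random_graph :: "nat \<Rightarrow> real \<Rightarrow> nat graph pmf" where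
  "binomial_random_graph n p =
     map_pmf (\<lambda>b. ({1..n}, {e \<in> all_pairs n. b e}))
       (Pi_pmf (all_pairs n) False (\<lambda>_. bernoulli_pmf p))"

definition num_copies :: "'a graph \<Rightarrow> 'b graph \<Rightarrow> nat" where
  "num_copies G K = card {F. subgraph F K \<and> isomorphic F G}"

definition mu :: "'a graph \<Rightarrow> nat \<Rightarrow> real \<Rightarrow> real" where
  "mu G n p =
     measure_pmf.expectation (binomial_random_graph n p) (\<lambda>K. real (num_copies G K))"

definition max_density :: "'a graph \<Rightarrow> real" where
  "max_density H =
     Max {real (card (edges F)) / real (card (verts F)) | F.
            subgraph F H \<and> card (verts F) \<ge> 1}"

definition Phi :: "'a graph \<Rightarrow> nat \<Rightarrow> real \<Rightarrow> real" where
  "Phi H n p = Min {mu G n p | G. subgraph G H \<and> card (edges G) \<ge> 1}"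

definition upper_tail_prob :: "'a graph \<Rightarrow> real \<Rightarrow> nat \<Rightarrow> real \<Rightarrow> real" where
  "upper_tail_prob H \<epsilon> n p =
     measure_pmf.prob (binomial_random_graph n p)
       {K. real (num_copies H K) \<ge> (1 + \<epsilon>) * mu H n p}"

end

theory Submission imports Defs "HOL-Real_Asymp.Real_Asymp" begin

text \<open>
  Write $q = np$. Since $m_H = 1$, the hypothesis says $q \to \infty$, and the edge and the cycle are
  the extremal subgraphs: $\Phi_H$ is of order $\min(nq, q^l)$. A vertex of degree $d$ on a cycle
  already creates of order $d^r$ copies, so $d$ of order $q^\alpha$ with $\alpha = 1 + l/r$ suffices,
  and $\alpha < l$ because $r \ge 2$. Fix $\alpha < \beta < l$.

  If $q^\beta \le n$, a cycle carrying such a star appears with probability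
  $\exp(- O(q^\alpha \log q))$. Planting the cycle would cost $\log(1/p)$, which can be too much
  when $q$ grows slowly; instead, the second moment method is applied to transversal copies of the
  cycle with a large star, which pays only a constant for the cycle.

  If $q^\beta > n$, plant the edges between $k$ hubs and everything else, where $k$ is of order
  $n p^{r+2} + 1$. This makes the conditional expectation of $X_H$ at least
  $2 (1 + \epsilon) \mu_H$, and as $X_H$ never exceeds $\mu_H / p^{l+r}$, a reverse Markov
  inequality costs only a factor $p^{l+r}$.
\<close>

subsection \<open>The binomial random graph\<close>


lemma finite_all_pairs: "finite (all_pairs n)"
  unfolding all_pairs_def by (rule finite_subset[of _ "Pow {1..n}"]) auto

lemma set_binomial_random_graph:
  assumes "K \<in> set_pmf (binomial_random_graph n p)"
  shows "verts K = {1..n}" "edges K \<subseteq> all_pairs n"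
  using assms unfolding binomial_random_graph_def by auto

lemma finite_set_binomial_random_graph: "finite (set_pmf (binomial_random_graph n p))"
proof (rule finite_subset)
  show "set_pmf (binomial_random_graph n p) \<subseteq> {{1..n}} \<times> Pow (all_pairs n)"
    using set_binomial_random_graph by (fastforce simp: mem_Times_iff)
qed (simp add: finite_all_pairs)

lemma integrable_binomial_random_graph:
  "integrable (measure_pmf (binomial_random_graph n p)) (f :: nat graph \<Rightarrow> real)"
  by (intro integrable_measure_pmf_finite finite_set_binomial_random_graph)

lemma prob_edges_supset:
  assumes "S \<subseteq> all_pairs n" "0 \<le> p" "p \<le> 1"
  shows "measure_pmf.prob (binomial_random_graph n p) {K. S \<subseteq> edges K} = p ^ card S"
proof -
  let ?B = "\<lambda>e. if e \<in> S then {True} else UNIV"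
  have "measure_pmf.prob (binomial_random_graph n p) {K. S \<subseteq> edges K}
      = measure_pmf.prob (Pi_pmf (all_pairs n) False (\<lambda>_. bernoulli_pmf p)) (Pi (all_pairs n) ?B)"
    unfolding binomial_random_graph_def measure_map_pmf
    using assms(1) by (intro arg_cong2[where f = measure] refl) (auto simp: Pi_def split: if_splits)
  also have "\<dots> = (\<Prod>e\<in>all_pairs n. measure_pmf.prob (bernoulli_pmf p) (?B e))"
    by (rule measure_Pi_pmf_Pi[OF finite_all_pairs])
  also have "\<dots> = (\<Prod>e\<in>all_pairs n. if e \<in> S then p else 1)"
    using assms by (intro prod.cong) (auto simp: measure_pmf_single)
  also have "\<dots> = (\<Prod>e\<in>S. p)"
    using assms(1) by (subst prod.inter_restrict[symmetric])
       (auto simp: finite_all_pairs Int_absorb1)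
  finally show ?thesis by simp
qed

lemma expectation_indicator_edges:
  assumes "S \<subseteq> all_pairs n" "0 \<le> p" "p \<le> 1"
  shows "measure_pmf.expectation (binomial_random_graph n p) (\<lambda>K. of_bool (S \<subseteq> edges K)) = p ^ card S"
proof -
  have "(\<lambda>K. of_bool (S \<subseteq> edges K) :: real) = indicator {K :: nat graph. S \<subseteq> edges K}"
    by (auto simp: indicator_def)
  then show ?thesis using prob_edges_supset[OF assms] by simp
qed

lemma prob_exists_ge_second_moment:
  fixes T :: "'i \<Rightarrow> nat set set"
  assumes p: "0 < p" "p \<le> 1" and I: "finite I" "I \<noteq> {}"
    and T: "\<And>i. i \<in> I \<Longrightarrow> T i \<subseteq> all_pairs n"
  shows "(\<Sum>i\<in>I. p ^ card (T i))\<^sup>2 / (\<Sum>i\<in>I. \<Sum>j\<in>I. p ^ card (T i \<union> T j))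
     \<le> measure_pmf.prob (binomial_random_graph n p) {K. \<exists>i\<in>I. T i \<subseteq> edges K}"
proof -
  let ?E = "measure_pmf.expectation (binomial_random_graph n p)"
  define N :: "nat graph \<Rightarrow> real" where "N K = (\<Sum>i\<in>I. of_bool (T i \<subseteq> edges K))" for K
  define A where "A = (\<Sum>i\<in>I. p ^ card (T i))"
  define B where "B = (\<Sum>i\<in>I. \<Sum>j\<in>I. p ^ card (T i \<union> T j))"
  have pos: "A > 0" "B > 0"
    unfolding A_def B_def using p I by (auto intro!: sum_pos)
  have EN: "?E N = A"
    unfolding N_def A_def using p T
    by (subst Bochner_Integration.integral_sum)
       (auto simp: integrable_binomial_random_graph expectation_indicator_edges)
  have N2: "(N K)\<^sup>2 = (\<Sum>i\<in>I. \<Sum>j\<in>I. of_bool (T i \<union> T j \<subseteq> edges K))" for K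
    unfolding N_def power2_eq_square sum_product by (intro sum.cong refl) auto
  have *: "?E (\<lambda>K. of_bool (T i \<union> T j \<subseteq> edges K)) = p ^ card (T i \<union> T j)"
    if "i \<in> I" "j \<in> I" for i j
    using p T that by (intro expectation_indicator_edges) auto
  have EN2: "?E (\<lambda>K. (N K)\<^sup>2) = B"
    unfolding N2 B_def using *
    by (simp add: Bochner_Integration.integral_sum integrable_binomial_random_graph
        del: Un_subset_iff le_sup_iff)
  define t where "t = B / A"
  have t: "t > 0" using pos by (simp add: t_def)
  have "A\<^sup>2 / B = 2 * A / t - B / t\<^sup>2"
    using pos by (simp add: t_def power2_eq_square field_simps)
  also have "\<dots> = ?E (\<lambda>K. 2 * N K / t - (N K)\<^sup>2 / t\<^sup>2)"
    by (subst Bochner_Integration.integral_diff)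
       (auto simp: integrable_binomial_random_graph EN EN2)
  also have "\<dots> \<le> ?E (indicator {K. \<exists>i\<in>I. T i \<subseteq> edges K})"
  proof (intro integral_mono integrable_binomial_random_graph)
    fix K :: "nat graph"
    have "0 \<le> (1 - N K / t)\<^sup>2" by simp
    then have "2 * N K / t - (N K)\<^sup>2 / t\<^sup>2 \<le> 1"
      by (simp add: power2_diff power_divide)
    moreover have "N K = 0" if "\<not> (\<exists>i\<in>I. T i \<subseteq> edges K)"
      using that unfolding N_def by (intro sum.neutral) auto
    ultimately show "2 * N K / t - (N K)\<^sup>2 / t\<^sup>2 \<le> indicator {K. \<exists>i\<in>I. T i \<subseteq> edges K} K"
      by (auto simp: indicator_def)
  qed
  finally show ?thesis
    by (simp add: A_def B_def)
qed

subsection \<open>Copies\<close>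

definition copies :: "nat \<Rightarrow> 'a graph \<Rightarrow> nat graph set" where
  "copies n G = {F. subgraph F ({1..n}, all_pairs n) \<and> isomorphic F G}"

lemma finite_copies: "finite (copies n G)"
proof (rule finite_subset)
  show "copies n G \<subseteq> Pow {1..n} \<times> Pow (all_pairs n)"
    by (auto simp: copies_def subgraph_def)
qed (simp add: finite_all_pairs)

lemma num_copies_eq_sum:
  assumes "verts K = {1..n}" "edges K \<subseteq> all_pairs n"
  shows "real (num_copies G K) = (\<Sum>F\<in>copies n G. of_bool (edges F \<subseteq> edges K))"
proof -
  have "{F. subgraph F K \<and> isomorphic F G} = {F \<in> copies n G. edges F \<subseteq> edges K}"
    using assms by (auto simp: copies_def subgraph_def)
  then show ?thesis
    by (simp add: num_copies_def finite_copies Int_def)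
qed

lemma simple_graph_edge_obtain:
  assumes "simple_graph G" "e \<in> edges G"
  obtains u v where "e = {u, v}" "u \<in> verts G" "v \<in> verts G" "u \<noteq> v"
proof -
  have "card e = 2" "e \<subseteq> verts G" using assms by (auto simp: simple_graph_def)
  then obtain u v where "e = {u, v}" "u \<noteq> v" by (auto simp: card_2_iff)
  with \<open>e \<subseteq> verts G\<close> show ?thesis by (intro that) auto
qed

lemma isomorphic_obtain_map:
  assumes "isomorphic F G" "simple_graph F" "simple_graph G"
  obtains g where "bij_betw g (verts G) (verts F)" "edges F = (`) g ` edges G"
proof -
  obtain f where f: "bij_betw f (verts F) (verts G)"
    and e: "\<And>u v. u \<in> verts F \<Longrightarrow> v \<in> verts F \<Longrightarrow> {u, v} \<in> edges F \<longleftrightarrow> {f u, f v} \<in> edges G"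
    using assms(1) unfolding isomorphic_def by blast
  define g where "g = inv_into (verts F) f"
  have g: "bij_betw g (verts G) (verts F)"
    unfolding g_def by (rule bij_betw_inv_into[OF f])
  have fg: "f (g a) = a" if "a \<in> verts G" for a
    using f that unfolding g_def by (simp add: bij_betw_inv_into_right)
  have gf: "g (f a) = a" if "a \<in> verts F" for a
    using f that unfolding g_def by (simp add: bij_betw_inv_into_left)
  have "edges F = (`) g ` edges G"
  proof (intro equalityI subsetI)
    fix x assume x: "x \<in> edges F"
    then obtain u v where uv: "x = {u, v}" "u \<in> verts F" "v \<in> verts F"
      using simple_graph_edge_obtain[OF assms(2)] by metis
    then have "x = g ` {f u, f v}" "{f u, f v} \<in> edges G" using e x gf by auto
    then show "x \<in> (`) g ` edges G" by blast
  next
    fix x assume "x \<in> (`) g ` edges G"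
    then obtain e where x: "x = g ` e" "e \<in> edges G" by blast
    obtain a b where "e = {a, b}" and ab: "a \<in> verts G" "b \<in> verts G"
      using simple_graph_edge_obtain[OF assms(3) x(2)] by metis
    with x have x: "x = {g a, g b}" "{a, b} \<in> edges G" by auto
    have "g a \<in> verts F" "g b \<in> verts F" using g ab by (auto dest: bij_betwE)
    then show "x \<in> edges F" using e[of "g a" "g b"] ab x fg by simp
  qed
  with g show ?thesis by (rule that)
qed

lemma card_edges_copies:
  assumes "F \<in> copies n G" "simple_graph G"
  shows "card (edges F) = card (edges G)"
proof -
  have "isomorphic F G" "simple_graph F"
    using assms by (auto simp: copies_def subgraph_def)
  then obtain g where g: "bij_betw g (verts G) (verts F)" "edges F = (`) g ` edges G"
    by (rule isomorphic_obtain_map[OF _ _ assms(2)])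
  have "inj_on ((`) g) (Pow (verts G))"
    using g(1) by (intro inj_on_image_Pow) (simp add: bij_betw_def)
  then have "inj_on ((`) g) (edges G)"
    by (rule inj_on_subset) (use assms(2) in \<open>auto simp: simple_graph_def\<close>)
  then show ?thesis by (simp add: g card_image)
qed

lemma card_copies_le:
  assumes "simple_graph G"
  shows "card (copies n G) \<le> n ^ card (verts G)"
proof -
  let ?M = "verts G \<rightarrow>\<^sub>E {1..n}"
  have fin: "finite (verts G)" using assms by (simp add: simple_graph_def)
  have "copies n G \<subseteq> (\<lambda>g. (g ` verts G, (`) g ` edges G)) ` ?M"
  proof
    fix F assume F: "F \<in> copies n G"
    then have iso: "isomorphic F G" "simple_graph F"
      by (auto simp: copies_def subgraph_def)
    obtain g where g: "bij_betw g (verts G) (verts F)" "edges F = (`) g ` edges G"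
      using isomorphic_obtain_map[OF iso assms] .
    have "e \<subseteq> verts G" if "e \<in> edges G" for e using assms that by (auto simp: simple_graph_def)
    then have "(`) (restrict g (verts G)) ` edges G = (`) g ` edges G"
      by (intro image_cong refl) (auto simp: subset_iff)
    moreover have "restrict g (verts G) ` verts G = verts F"
      using g(1) by (simp add: bij_betw_def)
    ultimately have "F = (restrict g (verts G) ` verts G, (`) (restrict g (verts G)) ` edges G)"
      using g(2) by (metis prod.collapse)
    moreover have "restrict g (verts G) \<in> ?M"
      using g(1) F by (auto simp: copies_def subgraph_def dest: bij_betwE)
    ultimately show "F \<in> (\<lambda>g. (g ` verts G, (`) g ` edges G)) ` ?M" by blast
  qed
  then have "card (copies n G) \<le> card ?M"
    using fin by (meson card_image_le card_mono finite_PiE finite_atLeastAtMost finite_imageI le_trans)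
  also have "\<dots> = n ^ card (verts G)" using fin by (simp add: card_PiE)
  finally show ?thesis .
qed

lemma mu_eq:
  assumes "simple_graph G" "0 \<le> p" "p \<le> 1"
  shows "mu G n p = real (card (copies n G)) * p ^ card (edges G)"
proof -
  have "mu G n p = measure_pmf.expectation (binomial_random_graph n p)
      (\<lambda>K. \<Sum>F\<in>copies n G. of_bool (edges F \<subseteq> edges K))"
    unfolding mu_def
    by (intro integral_cong_AE AE_pmfI) (auto simp: num_copies_eq_sum set_binomial_random_graph)
  also have "\<dots> = (\<Sum>F\<in>copies n G. p ^ card (edges F))"
    using assms by (subst Bochner_Integration.integral_sum)
      (auto simp: integrable_binomial_random_graph copies_def subgraph_def
        intro!: sum.cong expectation_indicator_edges)
  also have "\<dots> = (\<Sum>F\<in>copies n G. p ^ card (edges G))"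
    using assms by (intro sum.cong) (auto simp: card_edges_copies)
  finally show ?thesis by simp
qed

lemma transversal_copy:
  fixes K :: "nat graph"
  assumes G: "simple_graph G" and K: "edges K \<subseteq> all_pairs n" "verts K = {1..n}"
    and V: "disjoint_family_on V (verts G)" "\<And>i. i \<in> verts G \<Longrightarrow> V i \<subseteq> {1..n}"
    and f: "f \<in> Pi\<^sub>E (verts G) V" "\<And>e. e \<in> edges G \<Longrightarrow> f ` e \<in> edges K"
  shows "subgraph (f ` verts G, (`) f ` edges G) K" "isomorphic (f ` verts G, (`) f ` edges G) G"
proof -
  have inj: "inj_on f (verts G)"
  proof (rule inj_onI)
    fix i j assume ij: "i \<in> verts G" "j \<in> verts G" "f i = f j"
    then have "f i \<in> V i \<inter> V j" using f(1) by (auto simp: PiE_iff)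
    then show "i = j" using V(1) ij by (auto simp: disjoint_family_on_def)
  qed
  have sub: "e \<subseteq> verts G" if "e \<in> edges G" for e using G that by (auto simp: simple_graph_def)
  have "f ` verts G \<subseteq> {1..n}" using f(1) V(2) by (auto simp: PiE_iff)
  moreover have "card (f ` e) = 2 \<and> f ` e \<subseteq> f ` verts G" if "e \<in> edges G" for e
    using f(2)[OF that] K sub[OF that] by (auto simp: all_pairs_def)
  ultimately show "subgraph (f ` verts G, (`) f ` edges G) K"
    using K f(2) G by (auto simp: subgraph_def simple_graph_def)
  define g where "g = inv_into (verts G) f"
  have bij: "bij_betw g (f ` verts G) (verts G)"
    unfolding g_def by (intro bij_betw_inv_into bij_betw_imageI inj refl)
  have *: "{u, v} \<in> edges G" if "f ` {u, v} \<in> (`) f ` edges G" "u \<in> verts G" "v \<in> verts G" for u v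
  proof -
    obtain e where e: "e \<in> edges G" "f ` {u, v} = f ` e" using \<open>f ` {u, v} \<in> _\<close> by blast
    then have "{u, v} = e"
      using inj_on_image_eq_iff[OF inj, of "{u,v}" e] sub[OF e(1)] that by auto
    then show ?thesis using e by simp
  qed
  have "g (f u) = u" if "u \<in> verts G" for u using inj that by (simp add: g_def)
  then have "{u, v} \<in> (`) f ` edges G \<longleftrightarrow> {g u, g v} \<in> edges G"
    if uv: "u \<in> f ` verts G" "v \<in> f ` verts G" for u v
  proof -
    obtain a b where ab: "a \<in> verts G" "b \<in> verts G" "u = f a" "v = f b" using uv by blast
    then have "{u, v} = f ` {a, b}" by simp
    then have "{u, v} \<in> (`) f ` edges G \<longleftrightarrow> {a, b} \<in> edges G"
      using *[of a b] ab by (metis imageI)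
    then show ?thesis using ab \<open>\<And>u. u \<in> verts G \<Longrightarrow> g (f u) = u\<close> by simp
  qed
  then show "isomorphic (f ` verts G, (`) f ` edges G) G"
    unfolding isomorphic_def using bij by auto
qed

lemma inj_on_transversal:
  assumes "disjoint_family_on V I"
  shows "inj_on (\<lambda>f. (f ` I, E f)) (Pi\<^sub>E I V)"
proof (rule inj_onI)
  fix f g assume fg: "f \<in> Pi\<^sub>E I V" "g \<in> Pi\<^sub>E I V" "(f ` I, E f) = (g ` I, E g)"
  show "f = g"
  proof (rule PiE_ext[OF fg(1,2)])
    fix i assume i: "i \<in> I"
    then have "f i \<in> g ` I" using fg(3) by auto
    then obtain j where j: "j \<in> I" "f i = g j" by auto
    have "f i \<in> V i \<inter> V j" using fg(1,2) i j by (auto simp: PiE_iff)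
    then have "i = j" using assms i j by (auto simp: disjoint_family_on_def)
    then show "f i = g i" using j by simp
  qed
qed

lemma num_copies_ge_transversals:
  fixes K :: "nat graph"
  assumes G: "simple_graph G" and K: "edges K \<subseteq> all_pairs n" "verts K = {1..n}"
    and V: "disjoint_family_on V (verts G)" "\<And>i. i \<in> verts G \<Longrightarrow> V i \<subseteq> {1..n}"
    and f: "\<And>f e. f \<in> Pi\<^sub>E (verts G) V \<Longrightarrow> e \<in> edges G \<Longrightarrow> f ` e \<in> edges K"
  shows "(\<Prod>i\<in>verts G. card (V i)) \<le> num_copies G K"
proof -
  let ?c = "\<lambda>f. (f ` verts G, (`) f ` edges G)"
  have fin: "finite (verts G)" using G by (simp add: simple_graph_def)
  have "{F. subgraph F K \<and> isomorphic F G} \<subseteq> Pow {1..n} \<times> Pow (all_pairs n)"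
    using K by (auto simp: subgraph_def)
  then have fin': "finite {F. subgraph F K \<and> isomorphic F G}"
    by (rule finite_subset) (simp add: finite_all_pairs)
  have "(\<Prod>i\<in>verts G. card (V i)) = card (?c ` Pi\<^sub>E (verts G) V)"
    by (simp add: card_image[OF inj_on_transversal[OF V(1)]] card_PiE fin)
  also have "\<dots> \<le> num_copies G K"
    unfolding num_copies_def
    by (intro card_mono fin') (use transversal_copy[OF G K V _ f] in auto)
  finally show ?thesis .
qed

lemma exists_disjoint_classes:
  assumes "finite I" "(\<Sum>i\<in>I. c i) \<le> n"
  shows "\<exists>V. disjoint_family_on V I \<and> (\<forall>i\<in>I. V i \<subseteq> {1..n} \<and> card (V i) = c i)"
  using assms
proof (induction I rule: finite_induct)
  case empty
  then show ?case by (auto simp: disjoint_family_on_def)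
next
  case (insert a I)
  then obtain V where V: "disjoint_family_on V I" "\<forall>i\<in>I. V i \<subseteq> {1..n} \<and> card (V i) = c i"
    by auto
  let ?R = "{1..n} - (\<Union>i\<in>I. V i)"
  have "card (\<Union>i\<in>I. V i) \<le> (\<Sum>i\<in>I. c i)"
    using card_UN_le[OF insert(1), of V] V by simp
  then have "c a \<le> card ?R"
    using insert V by (subst card_Diff_subset) (auto intro: finite_subset)
  then obtain W where W: "W \<subseteq> ?R" "card W = c a"
    by (metis obtain_subset_with_card_n)
  have "disjoint_family_on (V(a := W)) (insert a I)"
    using V W insert(2) unfolding disjoint_family_on_def by (auto split: if_splits)
  moreover have "\<forall>i\<in>insert a I. (V(a := W)) i \<subseteq> {1..n} \<and> card ((V(a := W)) i) = c i"
    using V W insert(2) by auto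
  ultimately show ?case by blast
qed


subsection \<open>The second moment of transversal copies\<close>

text \<open>The graph with edges \<open>{i, nx i}\<close> has as many edges as vertices. If two transversal
  embeddings share the edge of \<open>i\<close> then they agree at \<open>i\<close>, so the second moment is bounded by a
  sum that factorises over the vertices.\<close>

lemma prob_blowup_ge:
  fixes V :: "'i \<Rightarrow> nat set" and nx :: "'i \<Rightarrow> 'i" and p :: real
  assumes p: "0 < p" "p \<le> 1" and I: "finite I"
    and V: "disjoint_family_on V I" "\<And>i. i \<in> I \<Longrightarrow> V i \<subseteq> {1..n}" "\<And>i. i \<in> I \<Longrightarrow> V i \<noteq> {}"
    and nx: "\<And>i. i \<in> I \<Longrightarrow> nx i \<in> I" "\<And>i. i \<in> I \<Longrightarrow> nx i \<noteq> i" "inj_on (\<lambda>i. {i, nx i}) I"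
  shows "(\<Prod>i\<in>I. card (V i) * p / (1 + card (V i) * p))
    \<le> measure_pmf.prob (binomial_random_graph n p)
        {K. \<exists>x\<in>Pi\<^sub>E I V. \<forall>i\<in>I. {x i, x (nx i)} \<in> edges K}"
proof -
  define X where "X = Pi\<^sub>E I V"
  define T where "T x = (\<lambda>i. {x i, x (nx i)}) ` I" for x :: "'i \<Rightarrow> nat"
  have finV: "finite (V i)" if "i \<in> I" for i using V(2)[OF that] finite_subset by blast
  have finX: "finite X" unfolding X_def using I finV by (rule finite_PiE)
  have neX: "X \<noteq> {}" unfolding X_def using V(3) by (simp add: PiE_eq_empty_iff)
  have class_eq: "i = j" if "x \<in> X" "y \<in> X" "i \<in> I" "j \<in> I" "x i = y j" for x y i j
  proof -
    have "x i \<in> V i \<inter> V j" using that by (auto simp: X_def PiE_iff)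
    then show ?thesis using V(1) that by (auto simp: disjoint_family_on_def)
  qed
  have edge_eq: "i = j \<and> x i = y j"
    if xy: "x \<in> X" "y \<in> X" "i \<in> I" "j \<in> I" and eq: "{x i, x (nx i)} = {y j, y (nx j)}" for x y i j
  proof -
    note c = class_eq[OF xy(1,2)]
    have "x i = y j \<and> x (nx i) = y (nx j) \<or> x i = y (nx j) \<and> x (nx i) = y j"
      using eq by (auto simp: doubleton_eq_iff)
    then have "{i, nx i} = {j, nx j}"
      using c[OF xy(3,4)] c[OF nx(1)[OF xy(3)] nx(1)[OF xy(4)]]
        c[OF xy(3) nx(1)[OF xy(4)]] c[OF nx(1)[OF xy(3)] xy(4)] by auto
    then have "i = j" using nx(3) xy by (auto simp: inj_on_def)
    then show ?thesis
      using eq c[OF xy(3) nx(1)[OF xy(4)]] nx(2)[OF xy(3)] by (auto simp: doubleton_eq_iff)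
  qed
  have sub: "T x \<subseteq> all_pairs n" if "x \<in> X" for x
  proof -
    have "{x i, x (nx i)} \<in> all_pairs n" if i: "i \<in> I" for i
    proof -
      have "x i \<in> V i" "x (nx i) \<in> V (nx i)" using \<open>x \<in> X\<close> i nx(1) by (auto simp: X_def PiE_iff)
      moreover have "x i \<noteq> x (nx i)"
        using class_eq[OF \<open>x \<in> X\<close> \<open>x \<in> X\<close> i nx(1)[OF i]] nx(2)[OF i] by auto
      ultimately show ?thesis using V(2)[OF i] V(2)[OF nx(1)[OF i]] by (auto simp: all_pairs_def)
    qed
    then show ?thesis by (auto simp: T_def)
  qed
  have cardT: "card (T x) = card I" if "x \<in> X" for x
    unfolding T_def by (intro card_image inj_onI) (use edge_eq[OF that that] in blast)
  have union: "p ^ card (T x \<union> T y) \<le> (\<Prod>i\<in>I. p * (if y i = x i then 1 else p))"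
    if x: "x \<in> X" and y: "y \<in> X" for x y
  proof -
    let ?J = "{i \<in> I. y i \<noteq> x i}"
    let ?T = "(\<lambda>i. {y i, y (nx i)}) ` ?J"
    have "card ?T = card ?J"
      by (intro card_image inj_onI) (use edge_eq[OF y y] in blast)
    moreover have "T x \<inter> ?T = {}"
      unfolding T_def using edge_eq[OF x y] by fastforce
    ultimately have "card I + card ?J = card (T x \<union> ?T)"
      using I cardT[OF x] by (simp add: card_Un_disjoint T_def)
    also have "\<dots> \<le> card (T x \<union> T y)"
      using I by (intro card_mono) (auto simp: T_def)
    finally have "p ^ card (T x \<union> T y) \<le> p ^ (card I + card ?J)"
      using p by (intro power_decreasing) auto
    also have "\<dots> = (\<Prod>i\<in>I. p) * (\<Prod>i\<in>?J. p)" by (simp add: power_add)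
    also have "(\<Prod>i\<in>?J. p) = (\<Prod>i\<in>I. if y i = x i then 1 else p)"
      unfolding prod.inter_filter[OF I] by (intro prod.cong) auto
    finally show ?thesis by (simp add: prod.distrib)
  qed
  define c where "c i = real (card (V i))" for i
  have c: "c i > 0" if "i \<in> I" for i
    using V(3)[OF that] finV[OF that] by (simp add: c_def card_gt_0_iff)
  have inner: "(\<Sum>y\<in>X. p ^ card (T x \<union> T y)) \<le> (\<Prod>i\<in>I. p * (1 + c i * p))" if x: "x \<in> X" for x
  proof -
    have "(\<Sum>y\<in>X. p ^ card (T x \<union> T y)) \<le> (\<Sum>y\<in>X. \<Prod>i\<in>I. p * (if y i = x i then 1 else p))"
      by (intro sum_mono union x)
    also have "\<dots> = (\<Prod>i\<in>I. \<Sum>b\<in>V i. p * (if b = x i then 1 else p))"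
      unfolding X_def by (rule prod_sum_PiE[symmetric]) (use I finV in auto)
    also have "\<dots> \<le> (\<Prod>i\<in>I. p * (1 + c i * p))"
    proof (intro prod_mono conjI)
      fix i assume i: "i \<in> I"
      show "0 \<le> (\<Sum>b\<in>V i. p * (if b = x i then 1 else p))" using p by (intro sum_nonneg) auto
      have "(\<Sum>b\<in>V i. (if b = x i then 1 else p)) \<le> (\<Sum>b\<in>V i. (if b = x i then 1 else 0) + p)"
        using p by (intro sum_mono) auto
      also have "\<dots> \<le> 1 + c i * p"
        using finV[OF i] by (simp add: sum.distrib c_def)
      finally show "(\<Sum>b\<in>V i. p * (if b = x i then 1 else p)) \<le> p * (1 + c i * p)"
        using p by (simp add: sum_distrib_left[symmetric])
    qed
    finally show ?thesis .
  qed
  define N where "N = (\<Prod>i\<in>I. c i)"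
  have N: "N > 0" "real (card X) = N"
    unfolding N_def X_def c_def using c I by (auto intro!: prod_pos simp: card_PiE c_def)
  have S1: "(\<Sum>x\<in>X. p ^ card (T x)) = N * p ^ card I"
    using N by (simp add: cardT)
  have S2: "(\<Sum>x\<in>X. \<Sum>y\<in>X. p ^ card (T x \<union> T y)) \<le> N * (\<Prod>i\<in>I. p * (1 + c i * p))"
    using sum_bounded_above[of X, OF inner] N by simp
  have S2pos: "(\<Sum>x\<in>X. \<Sum>y\<in>X. p ^ card (T x \<union> T y)) > 0"
    using p finX neX by (intro sum_pos) auto
  have "(\<Prod>i\<in>I. c i * p / (1 + c i * p)) = (\<Prod>i\<in>I. c i * (p * p) / (p * (1 + c i * p)))"
    using p by (intro prod.cong) auto
  also have "\<dots> = N * (p ^ card I * p ^ card I) / (\<Prod>i\<in>I. p * (1 + c i * p))"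
    unfolding prod_dividef prod.distrib N_def by simp
  also have "\<dots> = (N * p ^ card I)\<^sup>2 / (N * (\<Prod>i\<in>I. p * (1 + c i * p)))"
    using N by (simp add: power2_eq_square)
  also have "\<dots> \<le> (N * p ^ card I)\<^sup>2 / (\<Sum>x\<in>X. \<Sum>y\<in>X. p ^ card (T x \<union> T y))"
    by (intro divide_left_mono S2 mult_pos_pos[OF order.strict_trans2[OF S2pos S2] S2pos]) simp
  also have "\<dots> \<le> measure_pmf.prob (binomial_random_graph n p) {K. \<exists>x\<in>X. T x \<subseteq> edges K}"
    using prob_exists_ge_second_moment[where T = T, OF p finX neX sub] unfolding S1 by simp
  also have "{K :: nat graph. \<exists>x\<in>X. T x \<subseteq> edges K} = {K. \<exists>x\<in>X. \<forall>i\<in>I. {x i, x (nx i)} \<in> edges K}"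
    by (auto simp: T_def)
  finally show ?thesis unfolding c_def X_def .
qed

subsection \<open>Cycles with pendant edges\<close>

text \<open>Mapping \<open>i\<close> to \<open>{i, succ_vertex l i}\<close> enumerates the edges, for pendant vertices as well.\<close>

definition succ_vertex :: "nat \<Rightarrow> nat \<Rightarrow> nat" where
  "succ_vertex l i = (if i < l then (i + 1) mod l else 0)"

lemma succ_vertex_less: "0 < l \<Longrightarrow> succ_vertex l i < l"
  by (simp add: succ_vertex_def)

lemma succ_vertex_neq: "2 \<le> l \<Longrightarrow> succ_vertex l i \<noteq> i"
  by (auto simp: succ_vertex_def mod_if)

lemma succ_vertex_twice_neq: "3 \<le> l \<Longrightarrow> i < l \<Longrightarrow> succ_vertex l (succ_vertex l i) \<noteq> i"
  by (auto simp: succ_vertex_def mod_if)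

lemma inj_on_succ_edge:
  assumes "3 \<le> l"
  shows "inj_on (\<lambda>i. {i, succ_vertex l i}) I"
proof (rule inj_onI, rule ccontr)
  fix i j assume eq: "{i, succ_vertex l i} = {j, succ_vertex l j}" and "i \<noteq> j"
  then have "i = succ_vertex l j" "j = succ_vertex l i" by (auto simp: doubleton_eq_iff)
  then show False using succ_vertex_twice_neq[OF assms, of i] succ_vertex_less[of l j] assms by simp
qed

lemma verts_cycle_pendants: "verts (cycle_pendants l r) = {..<l + r}"
  by (simp add: cycle_pendants_def)

lemma edges_cycle_pendants:
  "edges (cycle_pendants l r) = (\<lambda>i. {i, succ_vertex l i}) ` {..<l + r}"
proof -
  have "(\<lambda>i. {i, succ_vertex l i}) ` {..<l + r}
      = (\<lambda>i. {i, succ_vertex l i}) ` {..<l} \<union> (\<lambda>i. {i, succ_vertex l i}) ` {l..<l + r}"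
    by (auto simp flip: image_Un intro!: arg_cong2[where f = "(`)"])
  also have "(\<lambda>i. {i, succ_vertex l i}) ` {..<l} = {{i, (i + 1) mod l} | i. i < l}"
    by (auto simp: succ_vertex_def)
  also have "(\<lambda>i. {i, succ_vertex l i}) ` {l..<l + r} = {{0, j} | j. l \<le> j \<and> j < l + r}"
    by (auto simp: succ_vertex_def insert_commute)
  finally show ?thesis by (simp add: cycle_pendants_def)
qed

lemma simple_graph_cycle_pendants:
  assumes "3 \<le> l"
  shows "simple_graph (cycle_pendants l r)"
proof -
  have "succ_vertex l i < l + r" "succ_vertex l i \<noteq> i" for i
    using succ_vertex_less[of l i] succ_vertex_neq[of l i] assms by auto
  then show ?thesis
    by (auto simp: simple_graph_def card_2_iff verts_cycle_pendants edges_cycle_pendants)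
qed

lemma card_edges_cycle_pendants: "3 \<le> l \<Longrightarrow> card (edges (cycle_pendants l r)) = l + r"
  by (simp add: edges_cycle_pendants card_image inj_on_succ_edge)

lemma prob_num_copies_ge_star:
  fixes p :: real and m s d :: nat
  assumes l: "3 \<le> l" and p: "0 < p" "p \<le> 1" and ms: "0 < m" "0 < s"
    and n: "l * m + r * d * s \<le> n"
  shows "(m * p / (1 + m * p)) ^ l * (s * p / (1 + s * p)) ^ (r * d)
    \<le> measure_pmf.prob (binomial_random_graph n p) {K. d ^ r \<le> num_copies (cycle_pendants l r) K}"
proof -
  define I where "I = {..<l + r * d}"
  have splitI: "I = {..<l} \<union> {l..<l + r * d}" "{..<l} \<inter> {l..<l + r * d} = {}"
    by (auto simp: I_def)
  define c where "c i = (if i < l then m else s)" for i :: nat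
  have "(\<Sum>i\<in>I. c i) = l * m + r * d * s"
    unfolding splitI(1) by (subst sum.union_disjoint) (auto simp: c_def)
  then obtain V where V: "disjoint_family_on V I" "\<And>i. i \<in> I \<Longrightarrow> V i \<subseteq> {1..n}"
      "\<And>i. i \<in> I \<Longrightarrow> card (V i) = c i"
    using exists_disjoint_classes[of I c n] n unfolding I_def by auto
  have ne: "V i \<noteq> {}" if "i \<in> I" for i using V(3)[OF that] ms by (auto simp: c_def split: if_splits)
  let ?nx = "succ_vertex l"
  have nx: "?nx i \<in> I" "?nx i < l" "?nx i \<noteq> i" for i
    using succ_vertex_less[of l i] succ_vertex_neq[of l i] l by (auto simp: I_def)
  have "(m * p / (1 + m * p)) ^ l * (s * p / (1 + s * p)) ^ (r * d)
      = (\<Prod>i\<in>I. c i * p / (1 + c i * p))"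
    unfolding splitI(1) by (subst prod.union_disjoint) (auto simp: c_def)
  also have "\<dots> = (\<Prod>i\<in>I. card (V i) * p / (1 + card (V i) * p))"
    by (intro prod.cong refl) (simp add: V)
  also have "\<dots> \<le> measure_pmf.prob (binomial_random_graph n p)
        {K. \<exists>x\<in>Pi\<^sub>E I V. \<forall>i\<in>I. {x i, x (?nx i)} \<in> edges K}"
    by (rule prob_blowup_ge[OF p _ V(1,2) ne nx(1,3) inj_on_succ_edge[OF l]]) (auto simp: I_def)
  also have "\<dots> \<le> measure_pmf.prob (binomial_random_graph n p)
      {K. d ^ r \<le> num_copies (cycle_pendants l r) K}"
  proof (intro measure_pmf.finite_measure_mono_AE AE_pmfI impI)
    fix K assume K: "K \<in> set_pmf (binomial_random_graph n p)"
      "K \<in> {K. \<exists>x\<in>Pi\<^sub>E I V. \<forall>i\<in>I. {x i, x (?nx i)} \<in> edges K}"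
    then obtain x where x: "x \<in> Pi\<^sub>E I V" "\<And>i. i \<in> I \<Longrightarrow> {x i, x (?nx i)} \<in> edges K" by auto
    have inj: "inj_on x I"
    proof (rule inj_onI)
      fix i j assume ij: "i \<in> I" "j \<in> I" "x i = x j"
      then have "x i \<in> V i \<inter> V j" using x(1) by (auto simp: PiE_iff)
      then show "i = j" using V(1) ij by (auto simp: disjoint_family_on_def)
    qed
    \<comment> \<open>the \<open>r * d\<close> leaves of the star fall into \<open>r\<close> blocks; a copy takes one leaf from each\<close>
    define B where "B i = (if i < l then {i} else {l + (i - l) * d..<l + (i - l) * d + d})" for i
    have Bsub: "B i \<subseteq> I" if "i < l + r" for i
    proof (cases "i < l")
      case False
      then have "Suc (i - l) \<le> r" using that by linarith
      then have "(i - l) * d + d \<le> r * d"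
        using mult_le_mono1[of "Suc (i - l)" r d] by simp
      then show ?thesis using False by (auto simp: B_def I_def)
    qed (auto simp: B_def I_def)
    have disjB: "B i \<inter> B j = {}" if "i \<noteq> j" for i j
    proof -
      have "l + (a - l) * d + d \<le> l + (b - l) * d" if "a < b" "l \<le> a" for a b
      proof -
      have "Suc (a - l) \<le> b - l" using that by linarith
      then show ?thesis using mult_le_mono1[of "Suc (a - l)" "b - l" d] by simp
    qed
      from this[of i j] this[of j i] that show ?thesis
        by (cases "i < j") (auto simp: B_def)
    qed
    define U where "U i = x ` B i" for i
    have cardU: "card (U i) = (if i < l then 1 else d)" if "i < l + r" for i
      unfolding U_def using inj_on_subset[OF inj Bsub[OF that]] by (simp add: card_image B_def)
    have disjU: "disjoint_family_on U {..<l + r}"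
      unfolding disjoint_family_on_def U_def
      using disjB Bsub inj by (auto simp: inj_on_image_Int[OF inj, symmetric])
    have subU: "U i \<subseteq> {1..n}" if "i < l + r" for i
      unfolding U_def using x(1) V(2) Bsub[OF that] by (fastforce simp: PiE_iff)
    have edge: "f ` e \<in> edges K"
      if f: "f \<in> Pi\<^sub>E {..<l + r} U" and e: "e \<in> edges (cycle_pendants l r)" for f e
    proof -
      obtain i where i: "i < l + r" "e = {i, ?nx i}" using e by (auto simp: edges_cycle_pendants)
      have "f i \<in> U i" using f i by (auto simp: PiE_iff)
      then obtain j where j: "j \<in> B i" "f i = x j" by (auto simp: U_def)
      have "?nx i < l + r" using nx(2)[of i] by simp
      then have "f (?nx i) \<in> U (?nx i)" using f by (auto simp: PiE_iff)
      then have "f (?nx i) = x (?nx i)" using nx(2)[of i] by (auto simp: U_def B_def)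
      moreover have "?nx j = ?nx i" using j(1) by (auto simp: B_def succ_vertex_def split: if_splits)
      moreover have "j \<in> I" using j(1) Bsub[OF i(1)] by auto
      ultimately show ?thesis using x(2)[of j] i j by simp
    qed
    have "{..<l + r} = {..<l} \<union> {l..<l + r}" "{..<l} \<inter> {l..<l + r} = {}" by auto
    then have "d ^ r = (\<Prod>i<l + r. card (U i))"
      using cardU by (simp add: prod.union_disjoint)
    also have "\<dots> \<le> num_copies (cycle_pendants l r) K"
      using num_copies_ge_transversals[OF simple_graph_cycle_pendants[OF l], of K n U r]
        set_binomial_random_graph[OF K(1)] disjU subU edge
      unfolding verts_cycle_pendants by auto
    finally show "K \<in> {K. d ^ r \<le> num_copies (cycle_pendants l r) K}" by simp
  qed auto
  finally show ?thesis .
qed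


subsection \<open>Planting\<close>

lemma upper_tail_prob_ge_planted:
  fixes p :: real
  assumes G: "simple_graph G" and p: "0 < p" "p \<le> 1" and \<epsilon>: "0 < \<epsilon>"
    and A: "A \<subseteq> all_pairs n" and J: "J \<subseteq> copies n G"
    and t: "\<And>F. F \<in> J \<Longrightarrow> card (edges F - A) \<le> t"
    and large: "2 * (1 + \<epsilon>) * mu G n p \<le> card J * p ^ t"
  shows "p ^ (card A + card (edges G)) \<le> upper_tail_prob G \<epsilon> n p"
proof (cases "copies n G = {}")
  case True
  then have "mu G n p = 0" using mu_eq[OF G, of p n] p by simp
  then show ?thesis using p by (simp add: upper_tail_prob_def power_le_one)
next
  case False
  let ?E = "measure_pmf.expectation (binomial_random_graph n p)"
  define M where "M = real (card (copies n G))"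
  have M: "M > 0" using False finite_copies[of n G] by (simp add: M_def card_gt_0_iff)
  define b where "b = (1 + \<epsilon>) * mu G n p"
  define W where "W = {K :: nat graph. b \<le> real (num_copies G K)}"
  have mu: "mu G n p = M * p ^ card (edges G)"
    unfolding M_def using p by (intro mu_eq G) auto
  have b: "b \<ge> mu G n p" "b \<ge> 0"
    using \<epsilon> mu M p by (auto simp: b_def)
  have FA: "edges F \<union> A \<subseteq> all_pairs n" if "F \<in> copies n G" for F
    using that A by (auto simp: copies_def subgraph_def)
  have finA: "finite A" using A finite_all_pairs finite_subset by blast
  have "2 * b * p ^ card A \<le> (\<Sum>F\<in>J. p ^ (card A + t))"
  proof -
    have "2 * (1 + \<epsilon>) * mu G n p * p ^ card A \<le> card J * p ^ t * p ^ card A"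
      using p by (intro mult_right_mono large) simp
    then show ?thesis by (simp only: b_def power_add mult_ac sum_constant)
  qed
  also have "\<dots> \<le> (\<Sum>F\<in>J. p ^ card (edges F \<union> A))"
  proof (intro sum_mono power_decreasing)
    fix F assume F: "F \<in> J"
    have "card (edges F \<union> A) = card (A \<union> (edges F - A))" by (simp add: Un_commute)
    also have "\<dots> \<le> card A + card (edges F - A)" by (rule card_Un_le)
    finally show "card (edges F \<union> A) \<le> card A + t" using t[OF F] by simp
  qed (use p in auto)
  also have "\<dots> \<le> (\<Sum>F\<in>copies n G. p ^ card (edges F \<union> A))"
    using J p by (intro sum_mono2 finite_copies) auto
  also have "\<dots> = (\<Sum>F\<in>copies n G. ?E (\<lambda>K. of_bool (edges F \<union> A \<subseteq> edges K)))"
    using p FA by (intro sum.cong expectation_indicator_edges[symmetric]) auto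
  also have "\<dots> = ?E (\<lambda>K. \<Sum>F\<in>copies n G. of_bool (edges F \<union> A \<subseteq> edges K))"
    by (subst Bochner_Integration.integral_sum) (auto simp: integrable_binomial_random_graph)
  also have "\<dots> \<le> ?E (\<lambda>K. b * of_bool (A \<subseteq> edges K) + M * indicator W K)"
  proof (intro integral_mono_AE integrable_binomial_random_graph AE_pmfI)
    fix K assume K: "K \<in> set_pmf (binomial_random_graph n p)"
    let ?S = "\<Sum>F\<in>copies n G. of_bool (edges F \<union> A \<subseteq> edges K) :: real"
    have S: "?S = (if A \<subseteq> edges K then real (num_copies G K) else 0)"
      using num_copies_eq_sum[OF set_binomial_random_graph[OF K], of G] by simp
    have "real (num_copies G K) \<le> (\<Sum>F\<in>copies n G. 1)"
      unfolding num_copies_eq_sum[OF set_binomial_random_graph[OF K]] by (intro sum_mono) simp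
    then have "real (num_copies G K) \<le> M" by (simp add: M_def)
    with S show "?S \<le> b * of_bool (A \<subseteq> edges K) + M * indicator W K"
      using b M by (cases "A \<subseteq> edges K"; cases "K \<in> W") (simp_all add: W_def)
  qed
  also have "\<dots> = b * p ^ card A + M * measure_pmf.prob (binomial_random_graph n p) W"
    using p A by (simp add: integrable_binomial_random_graph expectation_indicator_edges)
  finally have "b * p ^ card A \<le> M * measure_pmf.prob (binomial_random_graph n p) W" by simp
  moreover have "M * p ^ (card A + card (edges G)) \<le> b * p ^ card A"
    using mult_right_mono[OF b(1), of "p ^ card A"] p by (simp add: mu power_add mult_ac)
  ultimately have "M * p ^ (card A + card (edges G))
      \<le> M * measure_pmf.prob (binomial_random_graph n p) W" by linarith
  then show ?thesis using M by (simp add: upper_tail_prob_def W_def b_def)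
qed

lemma image_in_all_pairs:
  assumes "disjoint_family_on V I" "\<And>i. i \<in> I \<Longrightarrow> V i \<subseteq> {1..n}" "f \<in> Pi\<^sub>E I V"
    and "u \<in> I" "v \<in> I" "u \<noteq> v"
  shows "{f u, f v} \<in> all_pairs n"
proof -
  have f: "f u \<in> V u" "f v \<in> V v" using assms by (auto simp: PiE_iff)
  then have "f u \<noteq> f v" using assms(1,4,5,6) unfolding disjoint_family_on_def by fastforce
  with f show ?thesis using assms(2)[of u] assms(2)[of v] assms(4,5) by (auto simp: all_pairs_def)
qed

lemma upper_tail_prob_ge_hubs:
  fixes k m :: nat and p :: real
  assumes l: "3 \<le> l" and p: "0 < p" "p \<le> 1" and \<epsilon>: "0 < \<epsilon>"
    and n: "k + (l + r - 1) * m \<le> n"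
    and large: "2 * (1 + \<epsilon>) * mu (cycle_pendants l r) n p \<le> k * m ^ (l + r - 1) * p ^ (l - 2)"
  shows "p ^ (k * n + l + r) \<le> upper_tail_prob (cycle_pendants l r) \<epsilon> n p"
proof -
  define I where "I = {..<l + r}"
  let ?H = "cycle_pendants l r"
  let ?nx = "succ_vertex l"
  have splitI: "I = insert 0 {1..<l + r}" using l by (auto simp: I_def)
  define c where "c i = (if i = 0 then k else m)" for i :: nat
  have "(\<Sum>i\<in>I. c i) = k + (l + r - 1) * m"
    unfolding splitI by (subst sum.insert) (auto simp: c_def)
  then obtain V where V: "disjoint_family_on V I" "\<And>i. i \<in> I \<Longrightarrow> V i \<subseteq> {1..n}"
      "\<And>i. i \<in> I \<Longrightarrow> card (V i) = c i"
    using exists_disjoint_classes[of I c n] n unfolding I_def by auto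
  have I0: "0 \<in> I" using l by (simp add: I_def)
  have nx: "?nx i \<in> I" "?nx i \<noteq> i" for i
    using succ_vertex_less[of l i] succ_vertex_neq[of l i] l by (auto simp: I_def)
  define A where "A = {{a, b} | a b. a \<in> V 0 \<and> (\<exists>i\<in>I - {0}. b \<in> V i)}"
  have "A \<subseteq> all_pairs n"
  proof
    fix e assume "e \<in> A"
    then obtain a b i where e: "e = {a, b}" "a \<in> V 0" "b \<in> V i" "i \<in> I" "i \<noteq> 0"
      by (auto simp: A_def)
    then have "a \<noteq> b" using V(1) I0 unfolding disjoint_family_on_def by fastforce
    then show "e \<in> all_pairs n"
      using V(2)[OF I0] V(2)[OF e(4)] e by (auto simp: all_pairs_def)
  qed
  have cardA: "card A \<le> k * n"
  proof -
    have "A \<subseteq> (\<lambda>(a, b). {a, b}) ` (V 0 \<times> {1..n})"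
      using V(2) by (fastforce simp: A_def image_iff)
    moreover have "finite (V 0 \<times> {1..n})"
      using V(2)[OF I0] finite_subset by blast
    ultimately have "card A \<le> card (V 0 \<times> {1..n})"
      by (meson card_image_le card_mono finite_imageI le_trans)
    then show ?thesis using V(3)[OF I0] by (simp add: card_cartesian_product c_def)
  qed
  let ?c = "\<lambda>f. (f ` I, (`) f ` edges ?H)"
  define J where "J = ?c ` Pi\<^sub>E I V"
  have edges: "edges ?H = (\<lambda>i. {i, ?nx i}) ` I" and verts: "verts ?H = I"
    by (simp_all add: I_def edges_cycle_pendants verts_cycle_pendants)
  have J: "J \<subseteq> copies n ?H"
  proof -
    have "f ` e \<in> all_pairs n" if f: "f \<in> Pi\<^sub>E I V" and e: "e \<in> edges ?H" for f e
    proof -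
      obtain i where "i \<in> I" "e = {i, ?nx i}" using e unfolding edges by blast
      then show ?thesis using image_in_all_pairs[OF V(1,2) f _ nx(1)] nx(2)[of i] by auto
    qed
    then show ?thesis
      unfolding J_def copies_def
      using transversal_copy[OF simple_graph_cycle_pendants[OF l],
          of "({1..n}, all_pairs n)" n V r] V(1,2) unfolding verts by auto
  qed
  have "real (card J) = (\<Prod>i\<in>I. real (c i))"
  proof -
    have "card J = card (Pi\<^sub>E I V)"
      unfolding J_def by (rule card_image[OF inj_on_transversal[OF V(1)]])
    also have "\<dots> = (\<Prod>i\<in>I. c i)" using V(3) by (simp add: card_PiE I_def)
    finally show ?thesis by simp
  qed
  also have "\<dots> = k * m ^ (l + r - 1)"
    unfolding splitI by (subst prod.insert) (auto simp: c_def)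
  finally have cardJ: "real (card J) = k * m ^ (l + r - 1)" .
  have out: "card (edges F - A) \<le> l - 2" if F: "F \<in> J" for F
  proof -
    obtain f where f: "f \<in> Pi\<^sub>E I V" "edges F = (`) f ` edges ?H"
      using F by (auto simp: J_def)
    have fV: "f i \<in> V i" if "i \<in> I" for i using f(1) that by (auto simp: PiE_iff)
    have "edges F - A \<subseteq> (\<lambda>i. {f i, f (?nx i)}) ` {1..<l - 1}"
    proof
      fix e assume e: "e \<in> edges F - A"
      then obtain i where i: "i \<in> I" "e = {f i, f (?nx i)}"
        unfolding f(2) edges by auto
      have hub: "{f 0, f j} \<in> A" if "j \<in> I" "j \<noteq> 0" for j
        unfolding A_def using fV[OF I0] fV[OF that(1)] that by blast
      have "i \<noteq> 0" using e i hub[OF nx(1)[of 0] nx(2)[of 0]] by (cases "i = 0") auto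
      moreover have "?nx i \<noteq> 0"
        using e i hub[OF i(1)] nx(2)[of i] by (cases "?nx i = 0") (auto simp: insert_commute)
      ultimately have "i \<in> {1..<l - 1}"
        by (auto simp: succ_vertex_def mod_if split: if_splits)
      then show "e \<in> (\<lambda>i. {f i, f (?nx i)}) ` {1..<l - 1}" using i by blast
    qed
    then have "card (edges F - A) \<le> card {1..<l - 1}"
      by (meson card_image_le card_mono finite_atLeastLessThan finite_imageI le_trans)
    then show ?thesis by simp
  qed
  have "p ^ (k * n + l + r) \<le> p ^ (card A + card (edges ?H))"
    using cardA p l by (intro power_decreasing) (auto simp: card_edges_cycle_pendants)
  also have "\<dots> \<le> upper_tail_prob ?H \<epsilon> n p"
    using large cardJ
    by (intro upper_tail_prob_ge_planted[OF simple_graph_cycle_pendants[OF l] p \<epsilon>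
          \<open>A \<subseteq> all_pairs n\<close> J out]) auto
  finally show ?thesis .
qed

lemma subgraph_cycle_pendants_edges:
  assumes l: "3 \<le> l" and G: "subgraph G (cycle_pendants l r)" "verts G \<noteq> {}"
  shows "card (edges G) < card (verts G) \<or> card (edges G) = card (verts G) \<and> l \<le> card (verts G)"
proof -
  let ?nx = "succ_vertex l"
  let ?e = "\<lambda>i. {i, ?nx i}"
  have fin: "finite (verts G)" using G by (simp add: subgraph_def simple_graph_def)
  have nx0: "0 < l" using l by simp
  define S where "S = {i \<in> verts G. ?e i \<in> edges G}"
  have "edges G = ?e ` S"
  proof
    show "edges G \<subseteq> ?e ` S"
    proof
      fix e assume e: "e \<in> edges G"
      then obtain i where i: "e = ?e i"
        using G by (auto simp: subgraph_def edges_cycle_pendants)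
      then have "i \<in> verts G" using G e by (auto simp: subgraph_def simple_graph_def)
      then show "e \<in> ?e ` S" using e i by (auto simp: S_def)
    qed
  qed (auto simp: S_def)
  then have card: "card (edges G) = card S"
    by (simp add: card_image inj_on_succ_edge[OF l])
  have sub: "S \<subseteq> verts G" by (auto simp: S_def)
  show ?thesis
  proof (cases "S = verts G")
    case False
    then show ?thesis using card psubset_card_mono[OF fin] sub by (simp add: psubset_eq)
  next
    case True
    have step: "?nx i \<in> verts G" if "i \<in> verts G" for i
    proof -
      have "?e i \<in> edges G" using that True by (auto simp: S_def)
      then show ?thesis using G by (auto simp: subgraph_def simple_graph_def)
    qed
    obtain v where "v \<in> verts G" using G by auto
    then obtain a where a: "a < l" "a \<in> verts G"
      using step succ_vertex_less[OF nx0] by blast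
    have "(a + j) mod l \<in> verts G" for j
    proof (induction j)
      case (Suc j)
      have "(a + Suc j) mod l = ?nx ((a + j) mod l)"
        using nx0 by (simp add: succ_vertex_def mod_Suc_eq)
      then show ?case using step[OF Suc] by simp
    qed (use a in simp)
    then have "i \<in> verts G" if "i < l" for i
      using that a by (metis add.commute le_add_diff_inverse2 less_imp_le_nat mod_add_self2
          mod_less trans_le_add2 add_diff_inverse_nat diff_add_inverse not_less)
    then have "{..<l} \<subseteq> verts G" by auto
    then have "l \<le> card (verts G)" using card_mono[OF fin, of "{..<l}"] by simp
    then show ?thesis using card True by simp
  qed
qed

lemma mu_ge:
  fixes m :: nat and p :: real
  assumes G: "simple_graph G" and p: "0 \<le> p" "p \<le> 1" and m: "card (verts G) * m \<le> n"
  shows "real m ^ card (verts G) * p ^ card (edges G) \<le> mu G n p"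
proof -
  have fin: "finite (verts G)" using G by (simp add: simple_graph_def)
  obtain V where V: "disjoint_family_on V (verts G)" "\<And>i. i \<in> verts G \<Longrightarrow> V i \<subseteq> {1..n}"
      "\<And>i. i \<in> verts G \<Longrightarrow> card (V i) = m"
    using exists_disjoint_classes[OF fin, of "\<lambda>_. m" n] m by auto
  have "f ` e \<in> all_pairs n" if f: "f \<in> Pi\<^sub>E (verts G) V" and e: "e \<in> edges G" for f e
  proof -
    obtain u v where "e = {u, v}" "u \<in> verts G" "v \<in> verts G" "u \<noteq> v"
      using simple_graph_edge_obtain[OF G e] .
    then show ?thesis using image_in_all_pairs[OF V(1,2) f] by simp
  qed
  then have "(\<Prod>i\<in>verts G. card (V i)) \<le> num_copies G ({1..n}, all_pairs n)"
    by (intro num_copies_ge_transversals[OF G _ _ V(1,2)]) auto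
  then have "real (m ^ card (verts G)) \<le> real (card (copies n G))"
    using V(3) by (simp add: num_copies_def copies_def)
  then show ?thesis
    unfolding mu_eq[OF G p] using p by (intro mult_right_mono) auto
qed

lemma Phi_cycle_pendants_ge:
  fixes m :: nat and p :: real
  assumes l: "3 \<le> l" and p: "0 \<le> p" "p \<le> 1" and m: "(l + r) * m \<le> n" "1 \<le> m * p"
  shows "min (m * (m * p)) ((m * p) ^ l) \<le> Phi (cycle_pendants l r) n p"
proof -
  let ?H = "cycle_pendants l r"
  let ?S = "{G. subgraph G ?H \<and> card (edges G) \<ge> 1}"
  have "?S \<subseteq> Pow (verts ?H) \<times> Pow (edges ?H)" by (auto simp: subgraph_def)
  then have "finite ?S"
    by (rule finite_subset) (simp add: verts_cycle_pendants edges_cycle_pendants)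
  moreover have "?H \<in> ?S"
    using l simple_graph_cycle_pendants[OF l, of r]
    by (simp add: subgraph_def card_edges_cycle_pendants)
  moreover have "{mu G n p | G. subgraph G ?H \<and> card (edges G) \<ge> 1} = (\<lambda>G. mu G n p) ` ?S"
    by (rule setcompr_eq_image)
  ultimately have "Phi ?H n p \<in> (\<lambda>G. mu G n p) ` ?S"
    unfolding Phi_def by (metis (no_types, lifting) Min_in empty_iff finite_imageI image_is_empty)
  then obtain G where G: "subgraph G ?H" "1 \<le> card (edges G)" "Phi ?H n p = mu G n p" by auto
  have sG: "simple_graph G" using G by (simp add: subgraph_def)
  have "card (verts G) \<le> card {..<l + r}"
    using G(1) by (intro card_mono) (auto simp: subgraph_def verts_cycle_pendants)
  then have "card (verts G) * m \<le> (l + r) * m" by (intro mult_le_mono1) simp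
  then have "card (verts G) * m \<le> n"  using m(1) by (rule le_trans)
  then have mu: "real m ^ card (verts G) * p ^ card (edges G) \<le> mu G n p"
    by (intro mu_ge sG p)
  have m1: "1 \<le> real m" using m p by (cases m) auto
  obtain e where "e \<in> edges G" using G(2) by fastforce
  then have "verts G \<noteq> {}" using sG by (fastforce simp: simple_graph_def)
  from subgraph_cycle_pendants_edges[OF l G(1) this]
  have "min (m * (m * p)) ((m * p) ^ l) \<le> real m ^ card (verts G) * p ^ card (edges G)"
  proof
    assume lt: "card (edges G) < card (verts G)"
    have "real m * (m * p) ^ 1 \<le> m * (m * p) ^ card (edges G)"
      using m G(2) by (intro mult_left_mono power_increasing) auto
    also have "\<dots> = real m ^ Suc (card (edges G)) * p ^ card (edges G)"
      by (simp add: power_mult_distrib)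
    also have "\<dots> \<le> real m ^ card (verts G) * p ^ card (edges G)"
      using lt m1 p by (intro mult_right_mono power_increasing) auto
    finally show ?thesis by simp
  next
    assume eq: "card (edges G) = card (verts G) \<and> l \<le> card (verts G)"
    then have "(m * p) ^ l \<le> (m * p) ^ card (verts G)"
      using m by (intro power_increasing) auto
    then show ?thesis using eq by (simp add: power_mult_distrib)
  qed
  with mu show ?thesis using G(3) by linarith
qed

lemma max_density_cycle_pendants:
  assumes l: "3 \<le> l"
  shows "max_density (cycle_pendants l r) = 1"
proof -
  let ?H = "cycle_pendants l r"
  let ?S = "{F. subgraph F ?H \<and> card (verts F) \<ge> 1}"
  let ?d = "\<lambda>F :: nat graph. real (card (edges F)) / real (card (verts F))"
  have "?S \<subseteq> Pow (verts ?H) \<times> Pow (edges ?H)" by (auto simp: subgraph_def)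
  then have fin: "finite (?d ` ?S)"
    by (intro finite_imageI, rule finite_subset) (simp add: verts_cycle_pendants edges_cycle_pendants)
  have H: "?H \<in> ?S" "?d ?H = 1"
    using l simple_graph_cycle_pendants[OF l, of r]
    by (auto simp: subgraph_def card_edges_cycle_pendants verts_cycle_pendants)
  have le: "?d F \<le> 1" if "F \<in> ?S" for F
  proof -
    have "verts F \<noteq> {}" using that by auto
    then have "card (edges F) \<le> card (verts F)"
      using subgraph_cycle_pendants_edges[OF l, of F r] that by auto
    then show ?thesis using that by (auto simp: divide_le_eq)
  qed
  have "max_density ?H = Max (?d ` ?S)"
    unfolding max_density_def by (simp only: setcompr_eq_image)
  also have "\<dots> = 1"
    by (intro Max_eqI fin) (use le image_eqI[of 1 ?d, OF H(2)[symmetric] H(1)] in auto)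
  finally show ?thesis .
qed


subsection \<open>Upper tail bounds\<close>

lemma mu_cycle_pendants_le:
  fixes p :: real
  assumes "3 \<le> l" "0 \<le> p" "p \<le> 1"
  shows "mu (cycle_pendants l r) n p \<le> (n * p) ^ (l + r)"
proof -
  have "card (copies n (cycle_pendants l r)) \<le> n ^ (l + r)"
    using card_copies_le[OF simple_graph_cycle_pendants[OF assms(1)], of n r]
    by (simp add: verts_cycle_pendants)
  then have "real (card (copies n (cycle_pendants l r))) * p ^ (l + r) \<le> real (n ^ (l + r)) * p ^ (l + r)"
    using assms by (intro mult_right_mono) (auto simp del: of_nat_power)
  then show ?thesis
    using assms by (simp add: mu_eq simple_graph_cycle_pendants card_edges_cycle_pendants
        power_mult_distrib)
qed

lemma real_div_ge_half:
  assumes "0 < b" "b \<le> a"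
  shows "real a / (2 * real b) \<le> real (a div b)"
proof -
  have "b * (a div b) \<ge> b" using assms by (simp add: div_greater_zero_iff Suc_leI)
  then have "a \<le> 2 * (b * (a div b))"
    using mod_less_divisor[OF assms(1), of a] mult_div_mod_eq[of b a] by linarith
  then have "real a \<le> 2 * (real b * real (a div b))"
    by (metis of_nat_le_iff of_nat_mult of_nat_numeral)
  then show ?thesis using assms by (simp add: field_simps)
qed

lemma upper_tail_star_bound:
  fixes p \<epsilon> :: real
  defines "\<alpha> \<equiv> \<lambda>l r. 1 + real l / real r"
  assumes l: "3 \<le> l" and r: "1 \<le> r" and \<epsilon>: "0 < \<epsilon>" and p: "0 < p" "p \<le> 1"
    and q: "4 * real l \<le> n * p"
    and C: "C = r * (2 + \<epsilon>)"
    and small: "2 * (C * (n * p) powr \<alpha> l r) \<le> n"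
  shows "0 < upper_tail_prob (cycle_pendants l r) \<epsilon> n p"
    and "- ln (upper_tail_prob (cycle_pendants l r) \<epsilon> n p)
      \<le> l * ln 2 + C * (n * p) powr \<alpha> l r * ln (1 + 4 * (C * (n * p) powr \<alpha> l r) / (n * p))"
proof -
  define q where "q = n * p"
  define d where "d = nat \<lceil>(1 + \<epsilon>) * q powr \<alpha> l r\<rceil>"
  define D where "D = r * d"
  define m where "m = n div (2 * l)"
  define s where "s = n div (2 * D)"
  have q1: "q \<ge> 4 * l" "q > 1" using q l by (auto simp: q_def)
  have a1: "\<alpha> l r \<ge> 1" by (simp add: \<alpha>_def)
  have qa: "q powr \<alpha> l r \<ge> 1" using q1 a1 by (intro ge_one_powr_ge_zero) auto
  have "n > 0" using q1 by (auto simp: q_def intro!: Nat.gr0I)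
  have d: "(1 + \<epsilon>) * q powr \<alpha> l r \<le> d" "d \<le> (1 + \<epsilon>) * q powr \<alpha> l r + 1"
    using qa \<epsilon> unfolding d_def by (auto intro: real_nat_ceiling_ge of_nat_ceiling)
  have d0: "d > 0" using d(1) qa \<epsilon> by (cases d) (auto simp: mult_le_0_iff)
  have D0: "D > 0" using d0 r by (simp add: D_def)
  have "real d \<le> (2 + \<epsilon>) * q powr \<alpha> l r" using d(2) qa by (simp add: algebra_simps)
  then have "real r * real d \<le> real r * ((2 + \<epsilon>) * q powr \<alpha> l r)" by (intro mult_left_mono) auto
  then have DC: "real D \<le> C * q powr \<alpha> l r" by (simp add: D_def C mult.assoc)
  then have "2 * real D \<le> real n" using small by (simp add: q_def)
  then have Dn: "2 * D \<le> n" by linarith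
  have "q \<le> n" using p by (simp add: q_def mult_left_le)
  then have ln: "2 * l \<le> n" using q1 by linarith
  have "real n / (2 * real (2 * l)) \<le> m"
    unfolding m_def using l ln by (intro real_div_ge_half) auto
  then have "real n / (2 * real (2 * l)) * p \<le> m * p" using p by (intro mult_right_mono) auto
  moreover have "1 \<le> real n / (2 * real (2 * l)) * p" using q l by (simp add: field_simps)
  ultimately have mp: "1 \<le> m * p" by linarith
  have "real n / (2 * real (2 * D)) \<le> s"
    unfolding s_def using D0 Dn by (intro real_div_ge_half) auto
  then have "real n / (2 * real (2 * D)) * p \<le> s * p" using p by (intro mult_right_mono) auto
  then have sp: "q / (4 * D) \<le> s * p" by (simp add: q_def field_simps)
  have "0 < q / (4 * D)" using q1 D0 by simp
  then have sp0: "0 < s * p" using sp by linarith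
  have ms: "0 < m" "0 < s" using mp sp0 by (auto intro!: Nat.gr0I)
  have "2 * l * m \<le> n" "2 * D * s \<le> n" by (auto simp: m_def s_def)
  then have fit: "l * m + r * d * s \<le> n" by (simp add: D_def)
  let ?P = "upper_tail_prob (cycle_pendants l r) \<epsilon> n p"
  have "1 / (1 + 4 * real D / q) = (q / (4 * D)) / (1 + q / (4 * D))"
    using q1 D0 by (simp add: field_simps)
  also have "\<dots> \<le> s * p / (1 + s * p)"
  proof -
    have "x / (1 + x) \<le> y / (1 + y)" if "0 < x" "x \<le> y" for x y :: real
      using that by (simp add: field_simps)
    then show ?thesis using sp \<open>0 < q / (4 * D)\<close> by blast
  qed
  finally have s_frac: "1 / (1 + 4 * real D / q) \<le> s * p / (1 + s * p)" .
  have m_frac: "1 / 2 \<le> m * p / (1 + m * p)" using mp by (simp add: field_simps)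
  have "(1 + \<epsilon>) * mu (cycle_pendants l r) n p \<le> (1 + \<epsilon>) * q ^ (l + r)"
    using mu_cycle_pendants_le[of l p r n] l p \<epsilon> unfolding q_def by (intro mult_left_mono) auto
  also have "\<dots> \<le> (1 + \<epsilon>) ^ r * q ^ (l + r)"
    using r \<epsilon> q1 by (intro mult_right_mono self_le_power) auto
  also have "q ^ (l + r) = (q powr \<alpha> l r) ^ r"
  proof -
    have "(q powr \<alpha> l r) ^ r = q powr (\<alpha> l r * r)"
      using q1 by (simp add: powr_powr flip: powr_realpow)
    also have "\<alpha> l r * r = real (l + r)" using r by (simp add: \<alpha>_def field_simps)
    finally show ?thesis using q1 powr_realpow[of q "l + r"] by simp
  qed
  also have "(1 + \<epsilon>) ^ r * (q powr \<alpha> l r) ^ r \<le> real d ^ r"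
    unfolding power_mult_distrib[symmetric] using d(1) \<epsilon> by (intro power_mono) auto
  finally have target: "(1 + \<epsilon>) * mu (cycle_pendants l r) n p \<le> real (d ^ r)" by simp
  define L where "L = (1 / 2) ^ l * (1 / (1 + 4 * real D / q)) ^ D"
  have "L \<le> (m * p / (1 + m * p)) ^ l * (s * p / (1 + s * p)) ^ (r * d)"
    unfolding L_def D_def[symmetric] using s_frac m_frac q1 mp
    by (intro mult_mono power_mono) auto
  also have "\<dots> \<le> measure_pmf.prob (binomial_random_graph n p)
      {K. d ^ r \<le> num_copies (cycle_pendants l r) K}"
    by (rule prob_num_copies_ge_star[OF l p ms fit])
  also have "\<dots> \<le> ?P"
    unfolding upper_tail_prob_def
  proof (intro measure_pmf.finite_measure_mono subsetI)
    fix K :: "nat graph" assume "K \<in> {K. d ^ r \<le> num_copies (cycle_pendants l r) K}"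
    then have "real (d ^ r) \<le> real (num_copies (cycle_pendants l r) K)" by (simp only: of_nat_le_iff mem_Collect_eq)
    then show "K \<in> {K. (1 + \<epsilon>) * mu (cycle_pendants l r) n p \<le> real (num_copies (cycle_pendants l r) K)}"
      using target by (simp only: mem_Collect_eq)
  qed auto
  finally have LP: "L \<le> ?P" .
  have x0: "0 < 1 + 4 * real D / q" using q1 by (intro add_pos_nonneg) auto
  then have L0: "0 < L" by (simp add: L_def)
  then show P0: "0 < ?P" using LP by linarith
  have "- ln ?P \<le> - ln L" using LP L0 by simp
  also have "- ln L = l * ln 2 + D * ln (1 + 4 * real D / q)"
    unfolding L_def using x0 by (simp add: ln_mult ln_realpow ln_div power_one_over)
  also have "\<dots> \<le> l * ln 2 + C * q powr \<alpha> l r * ln (1 + 4 * (C * q powr \<alpha> l r) / q)"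
  proof (intro add_left_mono mult_mono DC)
    have "4 * real D / q \<le> 4 * (C * q powr \<alpha> l r) / q"
      using DC q1 by (intro divide_right_mono) auto
    then show "ln (1 + 4 * real D / q) \<le> ln (1 + 4 * (C * q powr \<alpha> l r) / q)"
      using x0 by (subst ln_le_cancel_iff) linarith+
    show "0 \<le> C * q powr \<alpha> l r" using DC by (rule order.trans[rotated]) simp
    show "0 \<le> ln (1 + 4 * real D / q)" using q1 by (intro ln_ge_zero) simp
  qed
  finally show "- ln ?P \<le> l * ln 2 + C * (n * p) powr \<alpha> l r * ln (1 + 4 * (C * (n * p) powr \<alpha> l r) / (n * p))"
    by (simp only: q_def)
qed

lemma upper_tail_hubs_bound:
  fixes p \<epsilon> :: real
  assumes l: "3 \<le> l" and \<epsilon>: "0 < \<epsilon>" and p: "0 < p" "p \<le> 1"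
    and C: "C = 2 * (1 + \<epsilon>) * (2 * (real l + real r)) ^ (l + r - 1)"
    and n: "l + r \<le> n" "C * n * p ^ (r + 2) + 1 \<le> n / (2 * (real l + real r))"
  shows "0 < upper_tail_prob (cycle_pendants l r) \<epsilon> n p"
    and "- ln (upper_tail_prob (cycle_pendants l r) \<epsilon> n p)
      \<le> (C * n * p ^ (r + 2) * n + 2 * real n) * ln (1 / p)"
proof -
  let ?P = "upper_tail_prob (cycle_pendants l r) \<epsilon> n p"
  define v where "v = l + r"
  define m where "m = n div v"
  define k where "k = nat \<lceil>C * n * p ^ (r + 2)\<rceil>"
  have v: "0 < v" "v \<le> n" "3 \<le> v" "real v = real l + real r" using l n by (auto simp: v_def)
  have C0: "C > 0" using \<epsilon> v unfolding C by (intro mult_pos_pos zero_less_power) auto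
  have k: "C * n * p ^ (r + 2) \<le> k" "k \<le> C * n * p ^ (r + 2) + 1"
    using C0 p unfolding k_def by (auto intro: real_nat_ceiling_ge of_nat_ceiling)
  have m: "n / (2 * real v) \<le> m" unfolding m_def by (rule real_div_ge_half[OF v(1,2)])
  have "real k \<le> real m" using k(2) m n(2) v(4) by simp
  then have "k + (v - 1) * m \<le> m + (v - 1) * m" by simp
  also have "\<dots> = v * m" using v by (cases v) auto
  also have "\<dots> \<le> n" by (simp add: m_def)
  finally have fit: "k + (l + r - 1) * m \<le> n" by (simp add: v_def)
  have "2 * (1 + \<epsilon>) * mu (cycle_pendants l r) n p \<le> 2 * (1 + \<epsilon>) * (n * p) ^ v"
    using mu_cycle_pendants_le[of l p r n] l p \<epsilon> unfolding v_def by (intro mult_left_mono) auto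
  also have "\<dots> = C * n * p ^ (r + 2) * (n / (2 * real v)) ^ (v - 1) * p ^ (l - 2)"
  proof -
    have "real n ^ v = n * real n ^ (v - 1)" using v(1) by (cases v) auto
    moreover have "p ^ v = p ^ (r + 2) * p ^ (l - 2)"
      unfolding power_add[symmetric] v_def using l by (intro arg_cong2[where f = power]) auto
    ultimately have "(n * p) ^ v = n * real n ^ (v - 1) * (p ^ (r + 2) * p ^ (l - 2))"
      by (simp add: power_mult_distrib)
    moreover have "C = 2 * (1 + \<epsilon>) * (2 * real v) ^ (v - 1)" by (simp add: C v_def)
    ultimately show ?thesis using v(1) by (simp add: power_divide)
  qed
  also have "\<dots> \<le> k * real m ^ (v - 1) * p ^ (l - 2)"
    using k(1) m p C0 by (intro mult_mono power_mono) auto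
  finally have LP: "p ^ (k * n + l + r) \<le> ?P"
    using upper_tail_prob_ge_hubs[OF l p \<epsilon> fit] by (simp add: v_def)
  have L0: "0 < p ^ (k * n + l + r)" using p by simp
  then show "0 < ?P" using LP by linarith
  have "- ln ?P \<le> - ln (p ^ (k * n + l + r))" using LP L0 by (simp del: zero_less_power_eq)
  also have "\<dots> = (real k * n + v) * ln (1 / p)"
    using p by (simp add: ln_realpow ln_div v_def)
  also have "\<dots> \<le> ((C * n * p ^ (r + 2) + 1) * n + n) * ln (1 / p)"
    using k v p by (intro mult_right_mono add_mono) (auto intro!: ln_ge_zero)
  also have "(C * n * p ^ (r + 2) + 1) * n + n = C * n * p ^ (r + 2) * n + 2 * real n"
    by (simp add: algebra_simps)
  finally show "- ln ?P \<le> (C * n * p ^ (r + 2) * n + 2 * real n) * ln (1 / p)" .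
qed

lemma Phi_cycle_pendants_ge_powers:
  fixes p :: real
  assumes l: "3 \<le> l" and p: "0 \<le> p" "p \<le> 1" and q: "2 * (real l + real r) \<le> n * p"
  shows "(1 / (2 * (real l + real r))) ^ l * min (n * (n * p)) ((n * p) ^ l) \<le> Phi (cycle_pendants l r) n p"
proof -
  define v where "v = l + r"
  define m where "m = n div v"
  define c where "c = 1 / (2 * real v)"
  have v: "3 \<le> v" "real v = real l + real r" using l by (auto simp: v_def)
  have "n * p \<le> n" using p by (simp add: mult_left_le)
  then have "real v \<le> real n" using q v(2) by auto
  then have "v \<le> n" by simp
  then have "n / (2 * real v) \<le> m" unfolding m_def using v by (intro real_div_ge_half) auto
  then have m: "c * n \<le> m" by (simp add: c_def)
  then have "c * n * p \<le> m * p" using p by (intro mult_right_mono) auto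
  then have mp: "c * (n * p) \<le> m * p" by (simp add: mult.assoc)
  moreover have "1 \<le> c * (n * p)" using q v by (simp add: c_def field_simps)
  ultimately have "1 \<le> m * p" by linarith
  moreover have "(l + r) * m \<le> n" by (simp add: m_def v_def)
  ultimately have Phi: "min (m * (m * p)) ((m * p) ^ l) \<le> Phi (cycle_pendants l r) n p"
    by (intro Phi_cycle_pendants_ge l p) auto
  have c: "0 < c" "c \<le> 1" using v by (auto simp: c_def)
  have "c ^ l * (n * (n * p)) \<le> c ^ 2 * (n * (n * p))"
    using c l p by (intro mult_right_mono power_decreasing) auto
  also have "\<dots> = (c * n) * (c * (n * p))" by (simp add: power2_eq_square)
  also have "\<dots> \<le> m * (m * p)" using c p by (intro mult_mono[OF m mp]) auto
  finally have 1: "c ^ l * (n * (n * p)) \<le> m * (m * p)" .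
  have "c ^ l * (n * p) ^ l = (c * (n * p)) ^ l" by (simp add: power_mult_distrib)
  also have "\<dots> \<le> (m * p) ^ l" using mp c p by (intro power_mono) auto
  finally have 2: "c ^ l * (n * p) ^ l \<le> (m * p) ^ l" .
  have "c ^ l * min (n * (n * p)) ((n * p) ^ l) = min (c ^ l * (n * (n * p))) (c ^ l * (n * p) ^ l)"
    using c by (simp add: min_mult_distrib_left)
  also have "\<dots> \<le> Phi (cycle_pendants l r) n p" using 1 2 Phi by (auto simp: min_def split: if_splits)
  finally show ?thesis by (simp add: c_def v)
qed

lemma star_cost_smallo:
  fixes \<alpha> \<beta> C :: real
  assumes "1 < \<alpha>" "\<alpha> < \<beta>" "0 < C"
  shows "(\<lambda>x. a + C * x powr \<alpha> * ln (1 + 4 * (C * x powr \<alpha>) / x)) \<in> o(\<lambda>x. x powr \<beta>)"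
  using assms by real_asymp

(* The first conjunct is part of the meaning of the asymptotic bound on - log P:
   Isabelle's ln 0 = 0 would otherwise make the second one trivial where P = 0. *)
theorem mainTheorem2:
  fixes l r :: nat and \<epsilon> :: real and p :: "nat \<Rightarrow> real"
  assumes "l \<ge> 3" and "r \<ge> 2"
    and "\<epsilon> > 0"
    and "\<And>n. 0 \<le> p n \<and> p n \<le> 1"
    and "(\<lambda>n. real n powr (- 1 / max_density (cycle_pendants l r))) \<in> o(p)"
    and "p \<in> o(\<lambda>_. 1)"
  shows "(\<forall>\<^sub>F n in sequentially. upper_tail_prob (cycle_pendants l r) \<epsilon> n (p n) > 0) \<and>
         (\<lambda>n. - ln (upper_tail_prob (cycle_pendants l r) \<epsilon> n (p n)))
           \<in> o(\<lambda>n. Phi (cycle_pendants l r) n (p n))"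
proof -
  note l = assms(1) and r = assms(2) and \<epsilon> = assms(3) and p01 = assms(4)
  define H where "H = cycle_pendants l r"
  define q where "q n = n * p n" for n
  define P where "P n = upper_tail_prob H \<epsilon> n (p n)" for n
  define \<alpha> where "\<alpha> = 1 + real l / real r"
  define \<beta> where "\<beta> = (\<alpha> + l) / 2"
  define C1 where "C1 = r * (2 + \<epsilon>)"
  define C2 where "C2 = 2 * (1 + \<epsilon>) * (2 * (real l + real r)) ^ (l + r - 1)"
  have "2 * (real l / real r) \<le> real l"
    using r mult_left_mono[of 2 "real r" "real l"] by (simp add: field_simps)
  then have "real l / real r < real l - 1" using l by linarith
  moreover have "0 < real l / real r" using l r by simp
  ultimately have "1 < \<alpha>" "\<alpha> < l" unfolding \<alpha>_def by linarith+
  then have ab: "1 < \<alpha>" "\<alpha> < \<beta>" "\<beta> < l" "1 < \<beta>" by (simp_all add: \<beta>_def)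
  have C1: "0 < C1" using r \<epsilon> by (simp add: C1_def)
  have C2: "0 < C2" using l \<epsilon> unfolding C2_def by (intro mult_pos_pos zero_less_power) auto

  have q_top: "filterlim q at_top sequentially"
    unfolding filterlim_at_top_gt[where c = 0]
  proof safe
    fix Z :: real assume Z: "0 < Z"
    have "\<forall>\<^sub>F n in sequentially. norm (real n powr - 1) \<le> 1 / Z * norm (p n)"
      using landau_o.smallD[OF assms(5), of "1 / Z"] Z by (simp add: max_density_cycle_pendants[OF l])
    then show "\<forall>\<^sub>F n in sequentially. Z \<le> q n"
      using eventually_gt_at_top[of 0]
    proof eventually_elim
      case (elim n)
      then have "1 / real n \<le> p n / Z"
        using p01[of n] by (simp add: powr_minus_divide)
      then show ?case using elim(2) Z by (simp add: q_def field_simps)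
    qed
  qed
  have p_0: "p \<longlonglongrightarrow> 0" using smalloD_tendsto[OF assms(6)] by simp
  have q_ge: "\<forall>\<^sub>F n in sequentially. Z \<le> q n" for Z
    using q_top by (simp add: filterlim_at_top)
  have p_pos: "\<forall>\<^sub>F n in sequentially. 0 < p n"
    using q_ge[of 1]
  proof eventually_elim
    case (elim n)
    then show ?case using p01[of n] by (cases "p n = 0") (auto simp: q_def)
  qed
  have p_right: "filterlim p (at_right 0) sequentially"
    unfolding filterlim_at using p_0 p_pos by (auto elim: eventually_mono)

  have main: "\<forall>\<^sub>F n in sequentially. 0 < P n \<and> - ln (P n) \<le> \<delta> * min (n * q n) (q n ^ l)"
    if \<delta>: "0 < \<delta>" for \<delta>
  proof -
    let ?star = "\<lambda>x. l * ln 2 + C1 * x powr \<alpha> * ln (1 + 4 * (C1 * x powr \<alpha>) / x)"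
    have "\<forall>\<^sub>F x in at_top. norm (?star x) \<le> \<delta> * norm (x powr \<beta>)"
      by (rule landau_o.smallD[OF star_cost_smallo[OF ab(1,2) C1] \<delta>])
    then have star: "\<forall>\<^sub>F n in sequentially. norm (?star (q n)) \<le> \<delta> * norm (q n powr \<beta>)"
      using q_top by (rule eventually_compose_filterlim)
    have "(\<lambda>x. 2 * (C1 * x powr \<alpha>)) \<in> o(\<lambda>x. x powr \<beta>)"
      using ab C1 by real_asymp
    from landau_o.smallD[OF this, of 1]
    have "\<forall>\<^sub>F x in at_top. norm (2 * (C1 * x powr \<alpha>)) \<le> 1 * norm (x powr \<beta>)" by simp
    then have size: "\<forall>\<^sub>F n in sequentially. norm (2 * (C1 * q n powr \<alpha>)) \<le> 1 * norm (q n powr \<beta>)"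
      using q_top by (rule eventually_compose_filterlim)
    have n_ln: "\<forall>\<^sub>F n in sequentially. norm (2 * real n * ln n) \<le> \<delta> / 2 * norm (real n powr \<gamma>)"
      if "1 < \<gamma>" for \<gamma>
    proof -
      have "(\<lambda>n. 2 * real n * ln n) \<in> o(\<lambda>n. real n powr \<gamma>)" using that by real_asymp
      from landau_o.smallD[OF this, of "\<delta> / 2"] show ?thesis using \<delta> by simp
    qed
    have "((\<lambda>n. C2 * (ln (real n) / n)) \<longlongrightarrow> 0) sequentially" by real_asymp
    from order_tendstoD(2)[OF this, of "\<delta> / 2"]
    have ln_n: "\<forall>\<^sub>F n in sequentially. C2 * (ln (real n) / n) < \<delta> / 2" using \<delta> by simp
    have "((\<lambda>x. C2 * (x * ln (1 / x))) \<longlongrightarrow> 0) (at_right 0)" by real_asymp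
    from order_tendstoD(2)[OF filterlim_compose[OF this p_right], of "\<delta> / 2"]
    have p_ln: "\<forall>\<^sub>F n in sequentially. C2 * (p n * ln (1 / p n)) < \<delta> / 2" using \<delta> by simp
    have p_small: "\<forall>\<^sub>F n in sequentially. p n < 1 / (C2 * (4 * (real l + real r)))"
      using l C2 by (intro order_tendstoD(2)[OF p_0] divide_pos_pos mult_pos_pos) auto
    have g: "1 < 1 + 1 / \<beta>" "1 < l / \<beta>" using ab by auto
    show ?thesis
      using star size n_ln[OF g(1)] n_ln[OF g(2)] ln_n p_ln p_small p_pos q_ge[of "4 * real l"]
        q_ge[of 1] eventually_ge_at_top[of "4 * (l + r)"]
    proof eventually_elim
      case (elim n)
      have n0: "real n > 0" using elim(11) l by simp
      show ?case
      proof (cases "q n powr \<beta> \<le> n")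
        case True
        have "2 * (C1 * (n * p n) powr (1 + real l / real r)) \<le> n"
          using elim(2) True C1 by (simp add: q_def \<alpha>_def)
        note bound = upper_tail_star_bound[OF l _ \<epsilon> elim(8) _ _ C1_def this]
        have pos: "0 < P n"
          unfolding P_def H_def using r p01[of n] elim(9) by (intro bound(1)) (auto simp: q_def)
        have "- ln (P n) \<le> ?star (q n)"
          unfolding P_def H_def q_def \<alpha>_def
          using r p01[of n] elim(9) by (intro bound(2)) (auto simp: q_def)
        also have "\<dots> \<le> \<delta> * q n powr \<beta>" using elim(1) by simp
        also have "\<dots> \<le> \<delta> * min (n * q n) (q n ^ l)"
        proof (intro mult_left_mono min.boundedI)
          have "real n * 1 \<le> n * q n" using elim(10) by (intro mult_left_mono) auto
          then show "q n powr \<beta> \<le> n * q n" using True by linarith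
          have "q n powr \<beta> \<le> q n powr l" using ab elim(10) by (intro powr_mono) auto
          then show "q n powr \<beta> \<le> q n ^ l" using elim(10) by (simp add: powr_realpow)
        qed (use \<delta> in simp)
        finally show ?thesis using pos by simp
      next
        case False
        have pn: "p n \<le> 1" "0 < p n" using p01 elim by auto
        have ln0: "0 \<le> ln (1 / p n)" using pn by simp
        have "1 / p n \<le> n" using elim(10) pn by (simp add: q_def field_simps)
        then have lnp: "ln (1 / p n) \<le> ln n" using pn n0 by (subst ln_le_cancel_iff) auto
        have "C2 * n * p n ^ (r + 2) \<le> C2 * n * p n ^ 1"
          using pn C2 by (intro mult_left_mono power_decreasing) auto
        also have "\<dots> \<le> n / (4 * (real l + real r))"
          using mult_left_mono[OF less_imp_le[OF elim(7)], of "C2 * n"] C2 by simp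
        finally have "C2 * n * p n ^ (r + 2) + 1 \<le> n / (4 * (real l + real r)) + 1" by simp
        also have "1 \<le> n / (4 * (real l + real r))" using elim(11) l by (simp add: field_simps)
        also have "n / (4 * (real l + real r)) + n / (4 * (real l + real r))
            = n / (2 * (real l + real r))"
        proof -
          have "x / (4 * y) + x / (4 * y) = x / (2 * y)" for x y :: real by simp
          then show ?thesis .
        qed
        finally have "C2 * n * p n ^ (r + 2) + 1 \<le> n / (2 * (real l + real r))" by simp
        note bound = upper_tail_hubs_bound[OF l \<epsilon> pn(2,1) C2_def _ this]
        have pos: "0 < P n" unfolding P_def H_def using elim(11) by (intro bound(1)) simp
        have "- ln (P n) \<le> (C2 * n * p n ^ (r + 2) * n + 2 * real n) * ln (1 / p n)"
          unfolding P_def H_def using elim(11) by (intro bound(2)) simp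
        also have "\<dots> = C2 * n * p n ^ (r + 2) * n * ln (1 / p n) + 2 * real n * ln (1 / p n)"
          by (simp add: algebra_simps)
        also have "\<dots> \<le> \<delta> / 2 * min (n * q n) (q n ^ l) + \<delta> / 2 * min (n * q n) (q n ^ l)"
        proof (rule add_mono)
          have "C2 * n * p n ^ (r + 2) * n * ln (1 / p n) \<le> C2 * n * p n ^ 2 * n * ln (1 / p n)"
            using pn C2 ln0 by (intro mult_right_mono mult_left_mono power_decreasing) auto
          also have "\<dots> = C2 * (p n * ln (1 / p n)) * (n * q n)"
            by (simp add: q_def power2_eq_square)
          also have "\<dots> \<le> \<delta> / 2 * (n * q n)"
            using elim(6,10) by (intro mult_right_mono) auto
          finally have 1: "C2 * n * p n ^ (r + 2) * n * ln (1 / p n) \<le> \<delta> / 2 * (n * q n)" .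
          have "C2 * n * p n ^ (r + 2) * n * ln (1 / p n) \<le> C2 * n * p n ^ 3 * n * ln n"
            using pn C2 ln0 lnp r by (intro mult_mono mult_left_mono power_decreasing) auto
          also have "\<dots> = C2 * (ln n / n) * q n ^ 3"
            using n0 by (simp add: q_def power3_eq_cube)
          also have "\<dots> \<le> \<delta> / 2 * q n ^ l"
            using elim(5,10) l \<delta> by (intro mult_mono power_increasing) auto
          finally have 2: "C2 * n * p n ^ (r + 2) * n * ln (1 / p n) \<le> \<delta> / 2 * q n ^ l" .
          show "C2 * n * p n ^ (r + 2) * n * ln (1 / p n) \<le> \<delta> / 2 * min (n * q n) (q n ^ l)"
            using 1 2 by (auto simp: min_def)
        next
          have q_ge_root: "real n powr (1 / \<beta>) \<le> q n"
          proof -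
            have "real n powr (1 / \<beta>) \<le> (q n powr \<beta>) powr (1 / \<beta>)"
              using False ab by (intro powr_mono2) auto
            then show ?thesis using ab elim(10) by (simp add: powr_powr)
          qed
          have le: "2 * real n * ln (1 / p n) \<le> 2 * real n * ln n" using lnp by (simp add: mult_left_mono)
          also have "\<dots> \<le> \<delta> / 2 * real n powr (1 + 1 / \<beta>)" using elim(3) by simp
          also have "\<dots> \<le> \<delta> / 2 * (n * q n)"
            using q_ge_root \<delta> n0 by (intro mult_left_mono) (auto simp: powr_add)
          finally have 1: "2 * real n * ln (1 / p n) \<le> \<delta> / 2 * (n * q n)" .
          note le
          also have "2 * real n * ln n \<le> \<delta> / 2 * real n powr (l / \<beta>)" using elim(4) by simp
          also have "real n powr (l / \<beta>) = (real n powr (1 / \<beta>)) ^ l"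
            using n0 by (simp add: powr_powr flip: powr_realpow)
          also have "\<delta> / 2 * (real n powr (1 / \<beta>)) ^ l \<le> \<delta> / 2 * q n ^ l"
            using q_ge_root \<delta> by (intro mult_left_mono power_mono) auto
          finally have 2: "2 * real n * ln (1 / p n) \<le> \<delta> / 2 * q n ^ l" .
          show "2 * real n * ln (1 / p n) \<le> \<delta> / 2 * min (n * q n) (q n ^ l)"
            using 1 2 by (auto simp: min_def)
        qed
        also have "\<dots> = \<delta> * min (n * q n) (q n ^ l)" by simp
        finally show ?thesis using pos by simp
      qed
    qed
  qed
  have "(\<lambda>n. - ln (P n)) \<in> o(\<lambda>n. Phi H n (p n))"
  proof (rule landau_o.smallI)
    fix c :: real assume c: "0 < c"
    define c0 where "c0 = (1 / (2 * (real l + real r))) ^ l"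
    have c0: "0 < c0" using l unfolding c0_def by (intro zero_less_power divide_pos_pos) auto
    have "\<forall>\<^sub>F n in sequentially. 0 < P n \<and> - ln (P n) \<le> (c * c0) * min (n * q n) (q n ^ l)"
      using c c0 by (intro main) simp
    then show "\<forall>\<^sub>F n in sequentially. norm (- ln (P n)) \<le> c * norm (Phi H n (p n))"
      using q_ge[of "2 * (real l + real r)"]
    proof eventually_elim
      case (elim n)
      have "c0 * min (n * q n) (q n ^ l) \<le> Phi H n (p n)"
        unfolding c0_def q_def H_def using l p01 elim(2)
        by (intro Phi_cycle_pendants_ge_powers) (auto simp: q_def)
      then have "c * (c0 * min (n * q n) (q n ^ l)) \<le> c * Phi H n (p n)"
        using c by (intro mult_left_mono) auto
      then have "- ln (P n) \<le> c * Phi H n (p n)" using elim(1) by (simp add: mult.assoc)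
      moreover have "P n \<le> 1" by (simp add: P_def upper_tail_prob_def)
      then have "ln (P n) \<le> 0" using elim(1) by simp
      ultimately show ?case using c by (smt (verit) mult_left_mono real_norm_def)
    qed
  qed
  moreover have "\<forall>\<^sub>F n in sequentially. P n > 0"
    using main[of 1] by (auto elim: eventually_mono)
  ultimately show ?thesis by (simp add: P_def H_def)
qed

end
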